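(* Let $\mathcal{G}$ be an undirected, unweighted cycle graph of order $n$, where $n$ is even. Consider sets $S_2=\{s_1,s_2\}$ of two noise-corrupted leaders ($0<k<\infty$). The optimal leader sets are precisely the pairs of nodes with maximal resistance distance $r_{s_1,s_2}=\frac n4$, which corresponds to geodesic distance $d_{s_1,s_2}=\frac n2$, i.e. the pairs of antipodal nodes.
   Context: Setting. $\mathcal{G}$ is the cycle on $n$ nodes ($n\ge 4$ even) with all edge weights equal to $1$, $A$ its adjacency matrix, $D$ the diagonal degree matrix, and $L=D-A$ the Laplacian. $L^+$ is the Moore-Penrose pseudoinverse of $L$. The geodesic distance $d_{i,j}$ is the number of edges in a shortest path from $i$ to $j$; the resistance distance is $r_{i,j}=L^+_{i,i}+L^+_{j,j}-2L^+_{i,j}$. Dynamics and error. For a set $S$ of nodes (leaders; here $S=\{s_1,s_2\}$ with $s_1\ne s_2$) and $k>0$, let $K$ be the diagonal matrix with $K_{i,i}=k$ for $i\in S$ and $K_{i,i}=0$ otherwise; $M=L+K$. For $\sigma>0$ the dynamics are $d\mathbf{x}=-M\mathbf{x}\,dt+\sigma\,d\mathbf{W}$, with $\mathbf{W}$ a vector of $n$ independent standard Wiener processes. $\Sigma$ is the steady-state covariance matrix of $\mathbf{x}$, i.e. the solution of $M\Sigma+\Sigma M^T=\sigma^2 I$. The total system error is $\mathrm{tr}(\Sigma)=\sum_{i=1}^n\Sigma_{i,i}=\frac{\sigma^2}{2}\sum_{i=1}^n (M^{-1})_{i,i}$. The leaders are called noise-corrupted if $0<k<\infty$. For given $m$ (here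 $m=2$), an optimal leader set is a set of $m$ nodes minimizing the total system error over all sets of $m$ nodes. *)

theory Defs
  imports
    "Graph_Theory.Graph_Theory"
    "Jordan_Normal_Form.Matrix"
    "HOL-Number_Theory.Cong"
begin

text \<open>
  Undirected, unweighted graphs are symmetric loop-free pair digraphs; a graph entering one of the
  matrix definitions below has the vertex set \<open>{..<n}\<close>, so that its nodes are the indices of
  \<open>n \<times> n\<close> matrices.
\<close>

definition cycle_graph :: "nat \<Rightarrow> nat pair_pre_digraph" where
  "cycle_graph n =
     \<lparr> pverts = {..<n},
       parcs = {(i, j). i < n \<and> j < n \<and> (j = Suc i mod n \<or> i = Suc j mod n)} \<rparr>"

lemma pair_graph_cycle_graph:
  assumes "3 \<le> n"
  shows "pair_graph (cycle_graph n)"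
proof
  show "fst e \<in> pverts (cycle_graph n)" if "e \<in> parcs (cycle_graph n)" for e
    using that by (auto simp: cycle_graph_def)
  show "snd e \<in> pverts (cycle_graph n)" if "e \<in> parcs (cycle_graph n)" for e
    using that by (auto simp: cycle_graph_def)
  show "finite (pverts (cycle_graph n))"
    by (simp add: cycle_graph_def)
  show "finite (parcs (cycle_graph n))"
    by (rule finite_subset[of _ "{..<n} \<times> {..<n}"]) (auto simp: cycle_graph_def)
  show "fst e \<noteq> snd e" if "e \<in> parcs (cycle_graph n)" for e
    using that assms by (auto simp: cycle_graph_def mod_Suc split: if_splits)
  show "symmetric (with_proj (cycle_graph n))"
    by (auto simp: cycle_graph_def symmetric_def sym_def)
qed

definition geodesic_distance :: "'a pair_pre_digraph \<Rightarrow> 'a \<Rightarrow> 'a \<Rightarrow> ereal" where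
  "geodesic_distance G u v = wf_digraph.\<mu> (with_proj G) (\<lambda>_. 1) u v"

definition adjacency_matrix :: "nat pair_pre_digraph \<Rightarrow> real mat" where
  "adjacency_matrix G =
     Matrix.mat (card (pverts G)) (card (pverts G)) (\<lambda>(i, j). if (i, j) \<in> parcs G then 1 else 0)"

definition degree_matrix :: "nat pair_pre_digraph \<Rightarrow> real mat" where
  "degree_matrix G = mat_diag (card (pverts G)) (\<lambda>i. real (out_degree (with_proj G) i))"

definition laplacian :: "nat pair_pre_digraph \<Rightarrow> real mat" where
  "laplacian G = degree_matrix G - adjacency_matrix G"

definition is_pseudoinverse :: "real mat \<Rightarrow> real mat \<Rightarrow> bool" where
  "is_pseudoinverse A X \<longleftrightarrow>
     X \<in> carrier_mat (dim_col A) (dim_row A) \<and>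
     A * X * A = A \<and> X * A * X = X \<and>
     transpose_mat (A * X) = A * X \<and> transpose_mat (X * A) = X * A"

definition pseudoinverse :: "real mat \<Rightarrow> real mat" where
  "pseudoinverse A = (THE X. is_pseudoinverse A X)"

definition resistance_distance :: "nat pair_pre_digraph \<Rightarrow> nat \<Rightarrow> nat \<Rightarrow> real" where
  "resistance_distance G i j =
     (let P = pseudoinverse (laplacian G) in P $$ (i, i) + P $$ (j, j) - 2 * P $$ (i, j))"

definition leader_matrix :: "nat pair_pre_digraph \<Rightarrow> real \<Rightarrow> nat set \<Rightarrow> real mat" where
  "leader_matrix G k S = mat_diag (card (pverts G)) (\<lambda>i. if i \<in> S then k else 0)"

definition dynamics_matrix :: "nat pair_pre_digraph \<Rightarrow> real \<Rightarrow> nat set \<Rightarrow> real mat" where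
  "dynamics_matrix G k S = laplacian G + leader_matrix G k S"

text \<open>
  The steady-state covariance of \<open>dx = - M x dt + \<sigma> dW\<close> is the solution of the Lyapunov equation,
  which is unique whenever \<open>M\<close> is positive definite.
\<close>

definition steady_state_covariance :: "real mat \<Rightarrow> real \<Rightarrow> real mat" where
  "steady_state_covariance M \<sigma> =
     (THE C. C \<in> carrier_mat (dim_row M) (dim_row M) \<and>
             M * C + C * transpose_mat M = \<sigma>\<^sup>2 \<cdot>\<^sub>m 1\<^sub>m (dim_row M))"

definition total_system_error :: "nat pair_pre_digraph \<Rightarrow> real \<Rightarrow> real \<Rightarrow> nat set \<Rightarrow> real" where
  "total_system_error G k \<sigma> S =
     sum_list (diag_mat (steady_state_covariance (dynamics_matrix G k S) \<sigma>))"

definition optimal_leader_set ::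
  "nat pair_pre_digraph \<Rightarrow> real \<Rightarrow> real \<Rightarrow> nat \<Rightarrow> nat set \<Rightarrow> bool" where
  "optimal_leader_set G k \<sigma> m S \<longleftrightarrow>
     S \<subseteq> pverts G \<and> card S = m \<and>
     (\<forall>T. T \<subseteq> pverts G \<and> card T = m \<longrightarrow> total_system_error G k \<sigma> S \<le> total_system_error G k \<sigma> T)"

definition max_resistance_pair :: "nat pair_pre_digraph \<Rightarrow> nat \<Rightarrow> nat \<Rightarrow> bool" where
  "max_resistance_pair G i j \<longleftrightarrow>
     i \<in> pverts G \<and> j \<in> pverts G \<and> i \<noteq> j \<and>
     (\<forall>u \<in> pverts G. \<forall>v \<in> pverts G. u \<noteq> v \<longrightarrow> resistance_distance G u v \<le> resistance_distance G i j)"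

end

theory Submission
  imports Defs
begin

text \<open>
  The trace of \<open>M\<inverse>\<close> is a strictly decreasing function of the resistance distance \<open>r\<close> of the two
  leaders, so the optimal pairs are the pairs that maximise \<open>r\<close>.
  
  On the cycle, \<open>r(i,j) = D (n - D) / n\<close> with \<open>D = \<bar>i - j\<bar>\<close> (the two arcs are resistors in parallel).
  As a function of \<open>i\<close> this has constant second difference except at \<open>i = j\<close>
  (lemma \<open>laplacian_cycle_resistance\<close>), which is all that is needed to verify closed forms for both matrix
  inverses: the pseudoinverse of \<open>L\<close> is \<open>(n\<^sup>2 - 1) / (12 n) - r / 2\<close>, and \<open>M\<inverse>\<close> is given below.
  
  The formula for \<open>M\<inverse>\<close> comes from electrical networks. Join each of the leaders \<open>s\<close> and \<open>t\<close> to the ground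
  by a resistor \<open>q = 1/k\<close>; then the diagonal entry of \<open>M\<inverse>\<close> at \<open>i\<close> is the effective resistance from \<open>i\<close>
  to the ground. With \<open>a = r(i,s)\<close>, \<open>b = r(i,t)\<close>, \<open>r = r(s,t)\<close>, replacing the network between \<open>i\<close>, \<open>s\<close>
  and \<open>t\<close> by an equivalent star gives
  \<open>(a + b) / 2 - r / 4 + q / 2 - (a - b)\<^sup>2 / (4 (r + 2 q))\<close>.
  Summing over \<open>i\<close> requires \<open>\<Sum> a = (n\<^sup>2 - 1) / 6\<close> and \<open>\<Sum> (a - b)\<^sup>2 = r (n r + 2) / 3\<close>
  (lemmas \<open>sum_cycle_resistance\<close> and \<open>sum_cycle_resistance_difference_squared\<close>); the second
  identity expresses the sum as a polynomial in \<open>r\<close>, which makes the monotonicity visible. The result is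
  \<open>(n\<^sup>2 - 1) / 6 + n q / 2 - n r / 4 - r (n r + 2) / (12 (r + 2 q))\<close>,
  in which both terms that involve \<open>r\<close> decrease.
  
  Since \<open>M\<close> is symmetric and positive definite, the Lyapunov equation has the unique solution
  \<open>(\<sigma>\<^sup>2 / 2) M\<inverse>\<close> (lemma \<open>steady_state_covariance_eqI\<close>), so the total error is \<open>\<sigma>\<^sup>2 / 2\<close> times this trace.
  Finally \<open>n/4 - r = (n - 2 D)\<^sup>2 / (4 n)\<close> shows that \<open>r\<close> is at most \<open>n/4\<close>, with equality exactly for
  \<open>D = n/2\<close>.
\<close>

section \<open>Sums and matrix products\<close>

lemma sum_mod_Suc:
  assumes "0 < n"
  shows "(\<Sum>i<n. f (Suc i mod n)) = (\<Sum>i<n. f i)"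
proof -
  obtain m where n: "n = Suc m"
    using assms gr0_implies_Suc by blast
  have "(\<Sum>i<n. f (Suc i mod n)) = (\<Sum>i<m. f (Suc i)) + f 0"
    by (simp add: n)
  also have "\<dots> = (\<Sum>i<n. f i)"
    unfolding n sum.lessThan_Suc_shift by (simp add: add.commute)
  finally show ?thesis .
qed

lemma sum_quadratic:
  assumes "p \<le> q"
  shows "(\<Sum>j = p..<q. a + b * real j + c * (real j)\<^sup>2) =
    (a * real q + b * real q * (real q - 1) / 2 + c * real q * (real q - 1) * (2 * real q - 1) / 6) -
    (a * real p + b * real p * (real p - 1) / 2 + c * real p * (real p - 1) * (2 * real p - 1) / 6)"
  using assms
  by (induction q rule: dec_induct) (auto simp: field_simps power2_eq_square)

lemma mult_mat_entry:
  assumes "A \<in> carrier_mat m l" "B \<in> carrier_mat l p" "i < m" "j < p"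
  shows "(A * B) $$ (i, j) = (\<Sum>h<l. A $$ (i, h) * B $$ (h, j))"
  using assms by (simp add: scalar_prod_def lessThan_atLeast0)

section \<open>The Laplacian of the cycle\<close>

text \<open>
  Writing the predecessor of \<open>i\<close> as \<open>(i + n - 1) mod n\<close> lets a row of the Laplacian be described by its two
  neighbouring columns without a case distinction at the ends of the index range.
\<close>

lemma pred_mod_iff:
  assumes "i < n" "j < n"
  shows "i = Suc j mod n \<longleftrightarrow> j = (i + n - 1) mod n"
proof (cases "i = 0")
  case True
  then show ?thesis using assms by (auto simp: mod_Suc)
next
  case False
  then have "(i + n - 1) mod n = i - 1"
    using assms by (metis Nat.add_diff_assoc2 One_nat_def Suc_leI bot_nat_0.not_eq_extremum less_imp_diff_less mod_add_self2 mod_less)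
  then show ?thesis using assms False by (auto simp: mod_Suc)
qed

lemma cycle_arcs_iff:
  assumes "i < n" "j < n"
  shows "(i, j) \<in> parcs (cycle_graph n) \<longleftrightarrow> j = Suc i mod n \<or> j = (i + n - 1) mod n"
  using assms by (auto simp: cycle_graph_def pred_mod_iff)

text \<open>
  This is where \<open>n \<ge> 3\<close> matters: otherwise both neighbours of a node coincide and its degree is not 2.
\<close>

lemma succ_neq_pred:
  assumes "3 \<le> n" "i < n"
  shows "Suc i mod n \<noteq> (i + n - 1) mod n"
proof
  assume eq: "Suc i mod n = (i + n - 1) mod n"
  have "i = Suc (Suc i mod n) mod n"
    using pred_mod_iff[of i n "Suc i mod n"] eq assms by simp
  then show False
    using assms by (auto simp: mod_Suc split: if_splits)
qed

lemma out_degree_cycle_graph: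
  assumes "3 \<le> n" "i < n"
  shows "out_degree (with_proj (cycle_graph n)) i = 2"
proof -
  have "out_arcs (with_proj (cycle_graph n)) i = {(i, Suc i mod n), (i, (i + n - 1) mod n)}"
    using assms cycle_arcs_iff[of i n]
    by (auto simp: out_arcs_def) (auto simp: cycle_graph_def)
  then show ?thesis
    using succ_neq_pred[OF assms] by (simp add: out_degree_def)
qed

lemma laplacian_cycle_entry:
  assumes "3 \<le> n" "i < n" "j < n"
  shows "laplacian (cycle_graph n) $$ (i, j) =
    (if j = i then 2 else 0) - (if j = Suc i mod n then 1 else 0)
      - (if j = (i + n - 1) mod n then 1 else 0)"
proof -
  have "card (pverts (cycle_graph n)) = n"
    by (simp add: cycle_graph_def)
  then show ?thesis
    using assms succ_neq_pred[of n i] cycle_arcs_iff[of i n j] out_degree_cycle_graph[of n j]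
    by (auto simp: laplacian_def degree_matrix_def adjacency_matrix_def mat_diag_def)
qed

lemma laplacian_carrier [simp]: "laplacian (cycle_graph n) \<in> carrier_mat n n"
  by (auto simp: laplacian_def degree_matrix_def adjacency_matrix_def cycle_graph_def
      intro!: minus_carrier_mat)

lemma laplacian_cycle_dims [simp]:
  "dim_row (laplacian (cycle_graph n)) = n" "dim_col (laplacian (cycle_graph n)) = n"
  using laplacian_carrier by (metis carrier_matD)+

lemma laplacian_cycle_apply:
  assumes "3 \<le> n" "i < n"
  shows "(\<Sum>j<n. laplacian (cycle_graph n) $$ (i, j) * x j) =
    2 * x i - x (Suc i mod n) - x ((i + n - 1) mod n)"
proof -
  have "(\<Sum>j<n. laplacian (cycle_graph n) $$ (i, j) * x j) =
    (\<Sum>j<n. (if j = i then 2 * x j else 0) - (if j = Suc i mod n then x j else 0)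
      - (if j = (i + n - 1) mod n then x j else 0))"
    using assms by (intro sum.cong) (auto simp: laplacian_cycle_entry)
  then show ?thesis
    using assms by (simp add: sum_subtractf sum.delta)
qed

lemma laplacian_cycle_sym:
  assumes "3 \<le> n" "i < n" "j < n"
  shows "laplacian (cycle_graph n) $$ (i, j) = laplacian (cycle_graph n) $$ (j, i)"
  using assms pred_mod_iff[of i n j] pred_mod_iff[of j n i]
  by (auto simp: laplacian_cycle_entry)

section \<open>Resistance on the cycle\<close>

definition cycle_resistance :: "nat \<Rightarrow> nat \<Rightarrow> nat \<Rightarrow> real" where
  "cycle_resistance n i j =
     \<bar>real i - real j\<bar> * (real n - \<bar>real i - real j\<bar>) / real n"

lemma cycle_resistance_commute: "cycle_resistance n i j = cycle_resistance n j i"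
  by (simp add: cycle_resistance_def abs_minus_commute)

lemma cycle_resistance_self [simp]: "cycle_resistance n i i = 0"
  by (simp add: cycle_resistance_def)

lemma cycle_resistance_nonneg:
  assumes "i < n" "j < n"
  shows "0 \<le> cycle_resistance n i j"
  using assms by (auto simp: cycle_resistance_def abs_if)

text \<open>
  As a function of \<open>i\<close>, the resistance is a concave parabola of period \<open>n\<close> with a kink at \<open>j\<close>: the parabola
  has constant second difference, and the kink contributes the exceptional value at \<open>i = j\<close>. Periodicity
  is what makes the steps from the last index to the first, and back, agree with the formula.
\<close>

lemma cycle_resistance_second_difference:
  assumes "2 \<le> n" "i < n" "j < n"
  shows "2 * cycle_resistance n i j - cycle_resistance n (Suc i mod n) j
      - cycle_resistance n ((i + n - 1) mod n) j = 2 / real n - (if i = j then 2 else 0)"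
proof -
  \<comment> \<open>The formula is symmetric under \<open>D \<mapsto> n - D\<close>, so the wrap-around can be ignored.\<close>
  have succ: "cycle_resistance n (Suc i mod n) j = cycle_resistance n (Suc i) j"
  proof (cases "Suc i = n")
    case True
    then show ?thesis
      using assms by (auto simp: cycle_resistance_def abs_if field_simps)
  next
    case False
    then show ?thesis using assms by simp
  qed
  have pred: "cycle_resistance n ((i + n - 1) mod n) j =
    (\<bar>real i - 1 - real j\<bar> * (real n - \<bar>real i - 1 - real j\<bar>) / real n)"
  proof (cases "i = 0")
    case True
    then show ?thesis
      using assms by (auto simp: cycle_resistance_def abs_if field_simps of_nat_diff)
  next
    case False
    then have "(i + n - 1) mod n = i - 1"
      using assms pred_mod_iff[of i n "i - 1"] by simp
    then show ?thesis
      using False by (simp add: cycle_resistance_def of_nat_diff)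
  qed
  consider "i = j" | "i < j" | "j < i" by linarith
  then show ?thesis
  proof cases
    case 1
    then show ?thesis
      unfolding succ pred using assms by (simp add: cycle_resistance_def field_simps)
  next
    case 2
    then have "real i + 1 \<le> real j" by linarith
    then show ?thesis
      unfolding succ pred using assms 2
      by (simp add: cycle_resistance_def field_simps)
  next
    case 3
    then have "real j + 1 \<le> real i" by linarith
    then show ?thesis
      unfolding succ pred using assms 3
      by (simp add: cycle_resistance_def field_simps)
  qed
qed

lemma laplacian_cycle_resistance:
  assumes "3 \<le> n" "i < n" "j < n"
  shows "(\<Sum>l<n. laplacian (cycle_graph n) $$ (i, l) * cycle_resistance n l j) =
    2 / real n - (if i = j then 2 else 0)"
  unfolding laplacian_cycle_apply[OF assms(1,2)]
  by (rule cycle_resistance_second_difference) (use assms in auto)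

text \<open>
  Independence of \<open>s\<close> is the symmetry of the cycle. The value also fixes the additive constant in the
  pseudoinverse of the Laplacian, whose rows must sum to zero.
\<close>

lemma sum_cycle_resistance:
  assumes "s < n"
  shows "(\<Sum>i<n. cycle_resistance n i s) = ((real n)\<^sup>2 - 1) / 6"
proof -
  let ?n = "real n" and ?s = "real s"
  let ?w = "\<lambda>i. \<bar>real i - ?s\<bar> * (?n - \<bar>real i - ?s\<bar>)"
  have "(\<Sum>i<n. ?w i) = (\<Sum>i = 0..<s. ?w i) + (\<Sum>i = s..<n. ?w i)"
    using assms unfolding lessThan_atLeast0
    by (simp only: sum.atLeastLessThan_concat less_imp_le le0)
  also have "(\<Sum>i = 0..<s. ?w i) =
      (\<Sum>i = 0..<s. ?s * (?n - ?s) + (2 * ?s - ?n) * real i + (- 1) * (real i)\<^sup>2)"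
    by (intro sum.cong) (auto simp: algebra_simps power2_eq_square)
  also have "(\<Sum>i = s..<n. ?w i) =
      (\<Sum>i = s..<n. - ?s * (?n + ?s) + (2 * ?s + ?n) * real i + (- 1) * (real i)\<^sup>2)"
    by (intro sum.cong) (auto simp: algebra_simps power2_eq_square)
  also have "(\<Sum>i = 0..<s. ?s * (?n - ?s) + (2 * ?s - ?n) * real i + (- 1) * (real i)\<^sup>2) +
      (\<Sum>i = s..<n. - ?s * (?n + ?s) + (2 * ?s + ?n) * real i + (- 1) * (real i)\<^sup>2) =
      ?n * ((?n\<^sup>2 - 1) / 6)"
    using assms by (simp only: sum_quadratic less_imp_le) (simp add: field_simps power2_eq_square)
  finally show ?thesis
    using assms by (simp add: cycle_resistance_def flip: sum_divide_distrib)
qed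

text \<open>
  The difference of the two parabolas is affine on each of the two arcs between \<open>s\<close> and \<open>t\<close>. In the
  index range the outer arc is cut at the node 0, which gives three intervals. The sum is computed for
  the numerators \<open>D (n - D)\<close>, so that all identities are polynomial.
\<close>

lemma sum_cycle_resistance_difference_squared_aux:
  assumes "s < t" "t < n"
  shows "(\<Sum>i<n. (cycle_resistance n i s - cycle_resistance n i t)\<^sup>2) =
    cycle_resistance n s t * (real n * cycle_resistance n s t + 2) / 3"
proof -
  let ?n = "real n" and ?s = "real s" and ?t = "real t"
  let ?w = "\<lambda>i j. \<bar>real i - real j\<bar> * (?n - \<bar>real i - real j\<bar>)"
  let ?d = "\<lambda>i. (?w i s - ?w i t)\<^sup>2"
  have expand: "(u * (v + w * x))\<^sup>2 = u\<^sup>2 * v\<^sup>2 + 2 * u\<^sup>2 * v * w * x + u\<^sup>2 * w\<^sup>2 * x\<^sup>2"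
    for u v w x :: real
    by (simp add: algebra_simps power2_eq_square)
  have "(\<Sum>i<n. ?d i) = (\<Sum>i = 0..<s. ?d i) + (\<Sum>i = s..<t. ?d i) + (\<Sum>i = t..<n. ?d i)"
    using assms unfolding lessThan_atLeast0
    by (simp only: sum.atLeastLessThan_concat less_imp_le le0)
  also have "(\<Sum>i = 0..<s. ?d i) =
      (\<Sum>i = 0..<s. ((?t - ?s) * ((?s + ?t - ?n) + (- 2) * real i))\<^sup>2)"
    using assms by (intro sum.cong refl arg_cong[of _ _ "\<lambda>x. x\<^sup>2"]) (simp add: algebra_simps)
  also have "(\<Sum>i = s..<t. ?d i) =
      (\<Sum>i = s..<t. ((?n - (?t - ?s)) * ((- ?s - ?t) + 2 * real i))\<^sup>2)"
    using assms by (intro sum.cong refl arg_cong[of _ _ "\<lambda>x. x\<^sup>2"]) (simp add: algebra_simps)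
  also have "(\<Sum>i = t..<n. ?d i) =
      (\<Sum>i = t..<n. ((?t - ?s) * ((?s + ?t + ?n) + (- 2) * real i))\<^sup>2)"
    using assms by (intro sum.cong refl arg_cong[of _ _ "\<lambda>x. x\<^sup>2"]) (simp add: algebra_simps)
  also have "(\<Sum>i = 0..<s. ((?t - ?s) * ((?s + ?t - ?n) + (- 2) * real i))\<^sup>2) +
      (\<Sum>i = s..<t. ((?n - (?t - ?s)) * ((- ?s - ?t) + 2 * real i))\<^sup>2) +
      (\<Sum>i = t..<n. ((?t - ?s) * ((?s + ?t + ?n) + (- 2) * real i))\<^sup>2) =
      ?n * (((?t - ?s) * (?n - (?t - ?s))) * ((?t - ?s) * (?n - (?t - ?s)) + 2) / 3)"
    using assms unfolding expand
    by (simp only: sum_quadratic less_imp_le) (simp add: field_simps power2_eq_square)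
  also have "(?t - ?s) * (?n - (?t - ?s)) = ?w s t"
    using assms by simp
  finally have sum_w: "(\<Sum>i<n. ?d i) = ?n * (?w s t * (?w s t + 2) / 3)" .
  have "(\<Sum>i<n. (cycle_resistance n i s - cycle_resistance n i t)\<^sup>2) = (\<Sum>i<n. ?d i) / ?n\<^sup>2"
    by (simp add: cycle_resistance_def power_divide sum_divide_distrib flip: diff_divide_distrib)
  also have "\<dots> = cycle_resistance n s t * (?n * cycle_resistance n s t + 2) / 3"
    using assms unfolding sum_w cycle_resistance_def by (simp add: power2_eq_square)
  finally show ?thesis .
qed

lemma sum_cycle_resistance_difference_squared:
  assumes "s < n" "t < n"
  shows "(\<Sum>i<n. (cycle_resistance n i s - cycle_resistance n i t)\<^sup>2) =
    cycle_resistance n s t * (real n * cycle_resistance n s t + 2) / 3"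
proof -
  consider "s = t" | "s < t" | "t < s" by linarith
  then show ?thesis
  proof cases
    case 1
    then show ?thesis by simp
  next
    case 2
    then show ?thesis using assms sum_cycle_resistance_difference_squared_aux by simp
  next
    case 3
    then show ?thesis
      using assms sum_cycle_resistance_difference_squared_aux[of t s n]
      by (simp add: power2_commute[of "cycle_resistance n _ s"] cycle_resistance_commute[of n s t])
  qed
qed

section \<open>The pseudoinverse of the Laplacian\<close>

text \<open>
  Uniqueness of the Moore-Penrose inverse: two pseudoinverses \<open>X\<close> and \<open>Y\<close> yield the same projections
  \<open>A X = A Y\<close> and \<open>X A = Y A\<close>, because a product of two of these symmetric projections, taken in either
  order, is one of the factors. Then \<open>X = X A X = X A Y = Y A Y = Y\<close>.
\<close>

lemma pseudoinverse_eqI: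
  assumes "is_pseudoinverse A X"
  shows "pseudoinverse A = X"
  unfolding pseudoinverse_def
proof (rule the_equality)
  fix Y assume Y: "is_pseudoinverse A Y"
  let ?m = "dim_row A" and ?n = "dim_col A"
  have A: "A \<in> carrier_mat ?m ?n" by simp
  have cX: "X \<in> carrier_mat ?n ?m" and cY: "Y \<in> carrier_mat ?n ?m"
    using assms Y by (auto simp: is_pseudoinverse_def)
  note X = assms[unfolded is_pseudoinverse_def] and Y = Y[unfolded is_pseudoinverse_def]
  have left: "A * X = A * Y"
  proof -
    have "A * X = (A * Y) * (A * X)"
      using A cX cY Y by (metis assoc_mult_mat mult_carrier_mat)
    also have "\<dots> = transpose_mat ((A * X) * (A * Y))"
      using transpose_mult[OF mult_carrier_mat[OF A cX] mult_carrier_mat[OF A cY]] X Y by simp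
    also have "(A * X) * (A * Y) = A * Y"
      using A cX cY X by (metis assoc_mult_mat mult_carrier_mat)
    finally show ?thesis using Y by simp
  qed
  have right: "X * A = Y * A"
  proof -
    have "X * A = (X * A) * (Y * A)"
      using A cX cY Y by (metis assoc_mult_mat mult_carrier_mat)
    also have "\<dots> = transpose_mat ((Y * A) * (X * A))"
      using transpose_mult[OF mult_carrier_mat[OF cY A] mult_carrier_mat[OF cX A]] X Y by simp
    also have "(Y * A) * (X * A) = Y * A"
      using A cX cY X by (metis assoc_mult_mat mult_carrier_mat)
    finally show ?thesis using Y by simp
  qed
  have "X = X * (A * X)"
    using A cX X by (metis assoc_mult_mat)
  also have "\<dots> = (X * A) * Y"
    using assoc_mult_mat[OF cX A cY] by (simp add: left)
  also have "\<dots> = Y"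
    using Y by (simp add: right)
  finally show "Y = X" ..
qed (use assms in simp)

definition cycle_laplacian_pinv :: "nat \<Rightarrow> real mat" where
  "cycle_laplacian_pinv n =
     Matrix.mat n n (\<lambda>(i, j). ((real n)\<^sup>2 - 1) / (12 * real n) - cycle_resistance n i j / 2)"

lemma transpose_mat_eqI:
  assumes "A \<in> carrier_mat n n" "\<And>i j. i < n \<Longrightarrow> j < n \<Longrightarrow> A $$ (i, j) = A $$ (j, i)"
  shows "transpose_mat A = A"
  using assms by (intro eq_matI) auto

lemma laplacian_transpose:
  assumes "3 \<le> n"
  shows "transpose_mat (laplacian (cycle_graph n)) = laplacian (cycle_graph n)"
  using laplacian_cycle_sym[OF assms] by (intro transpose_mat_eqI[of _ n]) auto

lemma sum_laplacian_row:
  assumes "3 \<le> n" "i < n"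
  shows "(\<Sum>j<n. laplacian (cycle_graph n) $$ (i, j)) = 0"
  using laplacian_cycle_apply[OF assms, of "\<lambda>_. 1"] by simp

text \<open>
  Both products of the two matrices are the centring matrix \<open>C = I - J / n\<close>, \<open>J\<close> the all-ones matrix. It
  is symmetric, and multiplying by it fixes every matrix whose rows sum to zero.
\<close>

lemma is_pseudoinverse_cycle_laplacian:
  assumes "3 \<le> n"
  shows "is_pseudoinverse (laplacian (cycle_graph n)) (cycle_laplacian_pinv n)"
proof -
  let ?L = "laplacian (cycle_graph n)" and ?P = "cycle_laplacian_pinv n"
  define C :: "real mat" where "C = Matrix.mat n n (\<lambda>(i, j). (if i = j then 1 else 0) - 1 / real n)"
  have carrier: "?L \<in> carrier_mat n n" "?P \<in> carrier_mat n n" "C \<in> carrier_mat n n"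
    by (auto simp: cycle_laplacian_pinv_def C_def)
  have C_transpose: "transpose_mat C = C"
    by (rule transpose_mat_eqI[of _ n]) (auto simp: C_def)
  have P_transpose: "transpose_mat ?P = ?P"
    by (rule transpose_mat_eqI[of _ n])
       (auto simp: cycle_laplacian_pinv_def cycle_resistance_commute)
  have LP: "?L * ?P = C"
  proof (rule eq_matI)
    fix i j assume ij: "i < dim_row C" "j < dim_col C"
    then have ij: "i < n" "j < n" by (auto simp: C_def)
    let ?r = "\<lambda>h. cycle_resistance n h j" and ?c = "((real n)\<^sup>2 - 1) / (12 * real n)"
    have "(?L * ?P) $$ (i, j) = (\<Sum>h<n. ?L $$ (i, h) * (?c - ?r h / 2))"
      using ij by (simp add: mult_mat_entry[OF carrier(1,2)]) (simp add: cycle_laplacian_pinv_def)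
    also have "\<dots> = ?c * (\<Sum>h<n. ?L $$ (i, h)) - (\<Sum>h<n. ?L $$ (i, h) * ?r h) / 2"
      unfolding sum_distrib_left sum_divide_distrib sum_subtractf[symmetric]
      by (intro sum.cong) (auto simp: algebra_simps)
    also have "\<dots> = C $$ (i, j)"
      using ij assms by (simp add: sum_laplacian_row laplacian_cycle_resistance C_def
          diff_divide_distrib)
    finally show "(?L * ?P) $$ (i, j) = C $$ (i, j)" .
  qed (use carrier in auto)
  have PL: "?P * ?L = C"
    using transpose_mult[OF carrier(1,2)] LP C_transpose P_transpose laplacian_transpose[OF assms]
    by simp
  have mult_C: "A * C = A"
    if A: "A \<in> carrier_mat n n" and rows: "\<And>i. i < n \<Longrightarrow> (\<Sum>h<n. A $$ (i, h)) = 0" for A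
  proof (rule eq_matI)
    fix i j assume "i < dim_row A" "j < dim_col A"
    then have ij: "i < n" "j < n" using A by auto
    have "(A * C) $$ (i, j) = (\<Sum>h<n. A $$ (i, h) * ((if h = j then 1 else 0) - 1 / real n))"
      using ij by (simp add: mult_mat_entry[OF A carrier(3)]) (simp add: C_def)
    also have "\<dots> = (\<Sum>h<n. (if h = j then A $$ (i, h) else 0)) - (\<Sum>h<n. A $$ (i, h)) / real n"
      unfolding sum_divide_distrib sum_subtractf[symmetric]
      by (intro sum.cong) (auto simp: right_diff_distrib)
    also have "\<dots> = A $$ (i, j)"
      using ij rows by (simp add: sum.delta)
    finally show "(A * C) $$ (i, j) = A $$ (i, j)" .
  qed (use A carrier in auto)
  have P_rows: "(\<Sum>h<n. ?P $$ (i, h)) = 0" if "i < n" for i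
  proof -
    have "(\<Sum>h<n. ?P $$ (i, h)) =
        (\<Sum>h<n. ((real n)\<^sup>2 - 1) / (12 * real n) - cycle_resistance n h i / 2)"
      using that
      by (intro sum.cong) (auto simp: cycle_laplacian_pinv_def cycle_resistance_commute)
    also have "\<dots> = 0"
      using that sum_cycle_resistance[of i n]
      by (simp add: sum_subtractf flip: sum_divide_distrib)
    finally show ?thesis .
  qed
  have "?L * ?P * ?L = ?L"
    using mult_C[OF carrier(1) sum_laplacian_row[OF assms]] assoc_mult_mat[OF carrier(1,2,1)]
    by (simp add: PL)
  moreover have "?P * ?L * ?P = ?P"
    using mult_C[OF carrier(2) P_rows] assoc_mult_mat[OF carrier(2,1,2)]
    by (simp add: LP)
  ultimately show ?thesis
    using carrier C_transpose by (auto simp: is_pseudoinverse_def LP PL)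
qed

lemma resistance_distance_cycle_graph:
  assumes "3 \<le> n" "i < n" "j < n"
  shows "resistance_distance (cycle_graph n) i j = cycle_resistance n i j"
  using assms
  by (simp add: resistance_distance_def
      pseudoinverse_eqI[OF is_pseudoinverse_cycle_laplacian] cycle_laplacian_pinv_def)
    (simp add: diff_divide_distrib)

section \<open>The Lyapunov equation\<close>

text \<open>
  Existence of the solution is immediate from \<open>M G = G M = I\<close>. For uniqueness, a difference \<open>X\<close> of two
  solutions satisfies \<open>M X + X M = 0\<close>. Pairing this equation entrywise with \<open>X\<close> gives the sum of the
  quadratic form of \<open>M\<close> over all columns and all rows of \<open>X\<close>; by positivity every column vanishes.
\<close>

lemma steady_state_covariance_eqI:
  assumes M: "M \<in> carrier_mat n n" and G: "G \<in> carrier_mat n n"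
    and sym: "transpose_mat M = M" "transpose_mat G = G"
    and inv: "M * G = 1\<^sub>m n"
    and pos: "\<And>x. \<exists>i<n. x i \<noteq> 0 \<Longrightarrow> 0 < (\<Sum>i<n. x i * (\<Sum>j<n. M $$ (i, j) * x j))"
  shows "steady_state_covariance M \<sigma> = (\<sigma>\<^sup>2 / 2) \<cdot>\<^sub>m G"
  unfolding steady_state_covariance_def
proof (rule the_equality)
  let ?Z = "(\<sigma>\<^sup>2 / 2) \<cdot>\<^sub>m G"
  have "G * M = 1\<^sub>m n"
    using transpose_mult[OF M G] sym inv by simp
  then have Z: "M * ?Z + ?Z * transpose_mat M = \<sigma>\<^sup>2 \<cdot>\<^sub>m 1\<^sub>m n"
    using M G inv sym by (intro eq_matI) (auto simp: mult_smult_distrib mult_smult_assoc_mat)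
  then show "?Z \<in> carrier_mat (dim_row M) (dim_row M) \<and>
      M * ?Z + ?Z * transpose_mat M = \<sigma>\<^sup>2 \<cdot>\<^sub>m 1\<^sub>m (dim_row M)"
    using M G by auto
  fix C assume "C \<in> carrier_mat (dim_row M) (dim_row M) \<and>
      M * C + C * transpose_mat M = \<sigma>\<^sup>2 \<cdot>\<^sub>m 1\<^sub>m (dim_row M)"
  then have C: "C \<in> carrier_mat n n" "M * C + C * M = \<sigma>\<^sup>2 \<cdot>\<^sub>m 1\<^sub>m n"
    using M sym by auto
  define X where "X i j = C $$ (i, j) - ?Z $$ (i, j)" for i j
  let ?q = "\<lambda>x. \<Sum>i<n. x i * (\<Sum>j<n. M $$ (i, j) * x j)"
  have q_nonneg: "0 \<le> ?q x" for x
    using pos[of x] by (cases "\<exists>i<n. x i \<noteq> 0") (auto simp: less_imp_le)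
  have homogeneous: "(\<Sum>h<n. M $$ (i, h) * X h j) + (\<Sum>h<n. M $$ (j, h) * X i h) = 0"
    if "i < n" "j < n" for i j
  proof -
    have entry: "(\<Sum>h<n. M $$ (i, h) * Y $$ (h, j)) + (\<Sum>h<n. M $$ (j, h) * Y $$ (i, h)) =
        (\<sigma>\<^sup>2 \<cdot>\<^sub>m 1\<^sub>m n) $$ (i, j)"
      if Y: "Y \<in> carrier_mat n n" "M * Y + Y * M = \<sigma>\<^sup>2 \<cdot>\<^sub>m 1\<^sub>m n" for Y
    proof -
      have M_sym: "M $$ (h, j) = M $$ (j, h)" if "h < n" for h
        using sym(1) M that \<open>j < n\<close> by (metis carrier_matD index_transpose_mat(1))
      have "(M * Y + Y * M) $$ (i, j) = (M * Y) $$ (i, j) + (Y * M) $$ (i, j)"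
        using M Y(1) \<open>i < n\<close> \<open>j < n\<close> by (subst index_add_mat(1)) auto
      also have "\<dots> = (\<Sum>h<n. M $$ (i, h) * Y $$ (h, j)) + (\<Sum>h<n. Y $$ (i, h) * M $$ (h, j))"
        using M Y \<open>i < n\<close> \<open>j < n\<close> by (simp only: mult_mat_entry[of _ n n _ n])
      also have "(\<Sum>h<n. Y $$ (i, h) * M $$ (h, j)) = (\<Sum>h<n. M $$ (j, h) * Y $$ (i, h))"
        by (intro sum.cong) (auto simp: M_sym)
      finally show ?thesis using Y by simp
    qed
    have "?Z \<in> carrier_mat n n" "M * ?Z + ?Z * M = \<sigma>\<^sup>2 \<cdot>\<^sub>m 1\<^sub>m n"
      using Z sym G by auto
    from entry[OF C] entry[OF this] show ?thesis
      unfolding X_def by (simp add: right_diff_distrib sum_subtractf)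
  qed
  have "(\<Sum>j<n. ?q (\<lambda>i. X i j)) + (\<Sum>i<n. ?q (\<lambda>j. X i j)) =
      (\<Sum>i<n. \<Sum>j<n. X i j * ((\<Sum>h<n. M $$ (i, h) * X h j) + (\<Sum>h<n. M $$ (j, h) * X i h)))"
    by (subst sum.swap) (simp add: distrib_left sum.distrib)
  also have "\<dots> = 0"
    using homogeneous by simp
  finally have "(\<Sum>j<n. ?q (\<lambda>i. X i j)) + (\<Sum>i<n. ?q (\<lambda>j. X i j)) = 0" .
  moreover have "0 \<le> (\<Sum>j<n. ?q (\<lambda>i. X i j))" "0 \<le> (\<Sum>i<n. ?q (\<lambda>j. X i j))"
    by (rule sum_nonneg, rule q_nonneg)+
  ultimately have "(\<Sum>j<n. ?q (\<lambda>i. X i j)) = 0"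
    by linarith
  note columns = this
  have q_zero: "?q (\<lambda>i. X i j) = 0" if "j < n" for j
    using sum_nonneg_0[of "{..<n}" "\<lambda>j. ?q (\<lambda>i. X i j)" j, OF finite_lessThan q_nonneg columns] that
    by blast
  have "X i j = 0" if "i < n" "j < n" for i j
  proof (rule ccontr)
    assume "X i j \<noteq> 0"
    with \<open>i < n\<close> have "\<exists>i<n. X i j \<noteq> 0" by blast
    from pos[OF this] q_zero[OF \<open>j < n\<close>] show False by linarith
  qed
  then show "C = ?Z"
    using C G by (intro eq_matI) (auto simp: X_def)
qed

section \<open>The dynamics matrix\<close>

lemma leader_matrix_cycle:
  "leader_matrix (cycle_graph n) k S = mat_diag n (\<lambda>i. if i \<in> S then k else 0)"
  by (simp add: leader_matrix_def cycle_graph_def)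

lemma dynamics_cycle_carrier [simp]: "dynamics_matrix (cycle_graph n) k S \<in> carrier_mat n n"
  by (simp add: dynamics_matrix_def leader_matrix_cycle)

lemma dynamics_cycle_dims [simp]:
  "dim_row (dynamics_matrix (cycle_graph n) k S) = n"
  "dim_col (dynamics_matrix (cycle_graph n) k S) = n"
  using dynamics_cycle_carrier by (metis carrier_matD)+

lemma dynamics_cycle_entry:
  assumes "i < n" "j < n"
  shows "dynamics_matrix (cycle_graph n) k S $$ (i, j) =
    laplacian (cycle_graph n) $$ (i, j) + (if j = i then if i \<in> S then k else 0 else 0)"
  using assms by (simp add: dynamics_matrix_def leader_matrix_cycle mat_diag_def)

lemma dynamics_cycle_apply:
  assumes "3 \<le> n" "i < n"
  shows "(\<Sum>j<n. dynamics_matrix (cycle_graph n) k S $$ (i, j) * x j) =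
    2 * x i - x (Suc i mod n) - x ((i + n - 1) mod n) + (if i \<in> S then k * x i else 0)"
proof -
  have "(\<Sum>j<n. dynamics_matrix (cycle_graph n) k S $$ (i, j) * x j) =
      (\<Sum>j<n. laplacian (cycle_graph n) $$ (i, j) * x j)
        + (\<Sum>j<n. if j = i then if i \<in> S then k * x j else 0 else 0)"
    unfolding sum.distrib[symmetric] using assms
    by (intro sum.cong) (auto simp: dynamics_cycle_entry algebra_simps)
  then show ?thesis
    using assms by (simp add: laplacian_cycle_apply sum.delta)
qed

text \<open>
  The Dirichlet energy of the cycle plus the energy lost at the leaders. For \<open>k > 0\<close> it
  vanishes only for vectors that are constant and zero at every leader, so \<open>M\<close> is positive definite as soon
  as there is a leader.
\<close>

lemma dynamics_cycle_energy:
  assumes "3 \<le> n"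
  shows "(\<Sum>i<n. x i * (\<Sum>j<n. dynamics_matrix (cycle_graph n) k S $$ (i, j) * x j)) =
    (\<Sum>i<n. (x i - x (Suc i mod n))\<^sup>2) + (\<Sum>i<n. if i \<in> S then k * (x i)\<^sup>2 else 0)"
proof -
  have "(\<Sum>i<n. x i * x ((i + n - 1) mod n)) =
      (\<Sum>i<n. x (Suc i mod n) * x ((Suc i mod n + n - 1) mod n))"
    using assms sum_mod_Suc[of n "\<lambda>i. x i * x ((i + n - 1) mod n)"] by simp
  also have "\<dots> = (\<Sum>i<n. x i * x (Suc i mod n))"
  proof (intro sum.cong refl)
    fix i assume "i \<in> {..<n}"
    then have "(Suc i mod n + n - 1) mod n = i"
      using pred_mod_iff[of "Suc i mod n" n i] by simp
    then show "x (Suc i mod n) * x ((Suc i mod n + n - 1) mod n) = x i * x (Suc i mod n)"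
      by simp
  qed
  finally have pred: "(\<Sum>i<n. x i * x ((i + n - 1) mod n)) = (\<Sum>i<n. x i * x (Suc i mod n))" .
  have succ: "(\<Sum>i<n. (x (Suc i mod n))\<^sup>2) = (\<Sum>i<n. (x i)\<^sup>2)"
    using assms by (intro sum_mod_Suc[of n "\<lambda>i. (x i)\<^sup>2"]) simp
  have "(\<Sum>i<n. x i * (\<Sum>j<n. dynamics_matrix (cycle_graph n) k S $$ (i, j) * x j)) =
      (\<Sum>i<n. 2 * (x i)\<^sup>2 - x i * x (Suc i mod n) - x i * x ((i + n - 1) mod n)
        + (if i \<in> S then k * (x i)\<^sup>2 else 0))"
    by (intro sum.cong refl, subst dynamics_cycle_apply)
       (use assms in \<open>auto simp: algebra_simps power2_eq_square\<close>)
  also have "\<dots> = 2 * (\<Sum>i<n. (x i)\<^sup>2) - 2 * (\<Sum>i<n. x i * x (Suc i mod n))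
      + (\<Sum>i<n. if i \<in> S then k * (x i)\<^sup>2 else 0)"
    using pred by (simp add: sum.distrib sum_subtractf flip: sum_distrib_left)
  also have "2 * (\<Sum>i<n. (x i)\<^sup>2) - 2 * (\<Sum>i<n. x i * x (Suc i mod n)) =
      (\<Sum>i<n. (x i)\<^sup>2) + (\<Sum>i<n. (x (Suc i mod n))\<^sup>2) - (\<Sum>i<n. 2 * (x i * x (Suc i mod n)))"
    unfolding succ by (simp flip: sum_distrib_left)
  also have "\<dots> = (\<Sum>i<n. (x i - x (Suc i mod n))\<^sup>2)"
    unfolding sum.distrib[symmetric] sum_subtractf[symmetric]
    by (intro sum.cong) (auto simp: power2_eq_square algebra_simps)
  finally show ?thesis .
qed

lemma dynamics_cycle_pos_def:
  assumes n: "3 \<le> n" and "0 < k" and s: "s < n" "s \<in> S" and x: "\<exists>i<n. x i \<noteq> 0"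
  shows "0 < (\<Sum>i<n. x i * (\<Sum>j<n. dynamics_matrix (cycle_graph n) k S $$ (i, j) * x j))"
proof (rule ccontr)
  let ?e = "\<Sum>i<n. (x i - x (Suc i mod n))\<^sup>2" and ?l = "\<Sum>i<n. if i \<in> S then k * (x i)\<^sup>2 else 0"
  assume "\<not> ?thesis"
  moreover have "0 \<le> ?e" "0 \<le> ?l"
    using \<open>0 < k\<close> by (auto intro!: sum_nonneg)
  ultimately have zero: "?e = 0" "?l = 0"
    unfolding dynamics_cycle_energy[OF n] by linarith+
  have "(x i - x (Suc i mod n))\<^sup>2 = 0" if "i < n" for i
    by (rule sum_nonneg_0[OF _ _ zero(1)]) (use that in auto)
  note adjacent = this
  have step: "x (Suc i) = x i" if "Suc i < n" for i
    using adjacent[of i] that by simp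
  have const: "x i = x 0" if "i < n" for i
    using that by (induction i) (simp_all add: step)
  have "(if s \<in> S then k * (x s)\<^sup>2 else 0) = 0"
    by (rule sum_nonneg_0[OF _ _ zero(2)]) (use s(1) \<open>0 < k\<close> in auto)
  then have "x s = 0"
    using s(2) \<open>0 < k\<close> by simp
  moreover obtain i where i: "i < n" "x i \<noteq> 0"
    using x by blast
  ultimately show False
    using const[OF i(1)] const[OF s(1)] by linarith
qed

text \<open>
  The Green function of the cycle grounded at \<open>s\<close> and \<open>t\<close>: the polarisation of the star-network
  expression for the effective resistance to the ground that is described at the beginning.
\<close>

definition two_leader_inverse :: "nat \<Rightarrow> real \<Rightarrow> nat \<Rightarrow> nat \<Rightarrow> real mat" where
  "two_leader_inverse n k s t = Matrix.mat n n (\<lambda>(i, j).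
     - cycle_resistance n i j / 2
     + (cycle_resistance n i s + cycle_resistance n i t) / 4
     + (cycle_resistance n j s + cycle_resistance n j t) / 4
     - cycle_resistance n s t / 4 + 1 / (2 * k)
     - (cycle_resistance n i s - cycle_resistance n i t)
       * (cycle_resistance n j s - cycle_resistance n j t)
       / (4 * (cycle_resistance n s t + 2 / k)))"

text \<open>
  For fixed \<open>j\<close>, the entries of column \<open>j\<close> are a combination \<open>g\<close> of the resistances to \<open>j\<close>, \<open>s\<close> and \<open>t\<close>. Its
  coefficients are such that the constant parts of the second differences cancel and that the
  remaining sources at \<open>s\<close> and \<open>t\<close>, of size \<open>-1/2 \<plusminus> 2 c\<close>, are compensated by the leader terms \<open>k g(s)\<close> and
  \<open>k g(t)\<close>.
\<close>

lemma dynamics_two_leader_inverse: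
  assumes n: "3 \<le> n" and k: "0 < k" and st: "s < n" "t < n" "s \<noteq> t"
  shows "dynamics_matrix (cycle_graph n) k {s, t} * two_leader_inverse n k s t = 1\<^sub>m n"
proof (rule eq_matI)
  fix i j assume "i < dim_row (1\<^sub>m n :: real mat)" "j < dim_col (1\<^sub>m n :: real mat)"
  then have ij: "i < n" "j < n" by auto
  let ?r = "cycle_resistance n" and ?M = "dynamics_matrix (cycle_graph n) k {s, t}"
  let ?R = "?r s t"
  define D where "D u = 2 * ?r i u - ?r (Suc i mod n) u - ?r ((i + n - 1) mod n) u" for u
  have D: "D u = 2 / real n - (if i = u then 2 else 0)" if "u < n" for u
    unfolding D_def by (rule cycle_resistance_second_difference) (use n ij that in auto)
  define c where "c = (?r j s - ?r j t) / (4 * (?R + 2 / k))"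
  define b where "b = (?r j s + ?r j t) / 4 - ?R / 4 + 1 / (2 * k)"
  define g where "g h = - ?r h j / 2 + (?r h s + ?r h t) / 4 + b - (?r h s - ?r h t) * c" for h
  have pos: "0 < ?R + 2 / k"
    using k cycle_resistance_nonneg[of s n t] st by (simp add: add_nonneg_pos)
  have "?r j s - ?r j t = c * (4 * (?R + 2 / k))"
    using pos by (simp add: c_def)
  then have c: "?r j s - ?r j t = 4 * c * ?R + 8 * c / k"
    by (simp add: algebra_simps)
  have "(?M * two_leader_inverse n k s t) $$ (i, j) = (\<Sum>h<n. ?M $$ (i, h) * g h)"
    using ij
    by (subst mult_mat_entry[of _ n n _ n])
       (auto simp: two_leader_inverse_def g_def b_def c_def algebra_simps intro!: sum.cong)
  also have "\<dots> = 2 * g i - g (Suc i mod n) - g ((i + n - 1) mod n)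
      + (if i \<in> {s, t} then k * g i else 0)"
    using n ij(1) by (rule dynamics_cycle_apply)
  also have "2 * g i - g (Suc i mod n) - g ((i + n - 1) mod n) =
      - D j / 2 + (D s + D t) / 4 - (D s - D t) * c"
    by (simp add: g_def D_def field_simps)
  also have "\<dots> = (if i = j then 1 else 0) - (if i = s then 1 / 2 else 0) - (if i = t then 1 / 2 else 0)
      + 2 * c * ((if i = s then 1 else 0) - (if i = t then 1 else 0))"
    unfolding D[OF ij(2)] D[OF st(1)] D[OF st(2)]
    by (simp add: algebra_simps add_divide_distrib diff_divide_distrib)
  also have "\<dots> + (if i \<in> {s, t} then k * g i else 0) = (if i = j then 1 else 0)"
  proof -
    have "g s = 1 / (2 * k) - 2 * c / k" "g t = 1 / (2 * k) + 2 * c / k"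
      using c by (simp_all add: g_def b_def cycle_resistance_commute[of n _ j]
          cycle_resistance_commute[of n t s] add_divide_distrib diff_divide_distrib algebra_simps)
    then have "k * g s = 1 / 2 - 2 * c" "k * g t = 1 / 2 + 2 * c"
      using k by (simp_all add: field_simps)
    then show ?thesis
      using st(3) by auto
  qed
  finally show "(?M * two_leader_inverse n k s t) $$ (i, j) = 1\<^sub>m n $$ (i, j)"
    using ij by simp
qed (auto simp: two_leader_inverse_def)

section \<open>The total system error\<close>

definition two_leader_trace :: "nat \<Rightarrow> real \<Rightarrow> real \<Rightarrow> real" where
  "two_leader_trace n k r = ((real n)\<^sup>2 - 1) / 6 + real n / (2 * k) - real n * r / 4
     - r * (real n * r + 2) / (12 * (r + 2 / k))"

lemma total_system_error_cycle:
  assumes n: "3 \<le> n" and k: "0 < k" and st: "s < n" "t < n" "s \<noteq> t"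
  shows "total_system_error (cycle_graph n) k \<sigma> {s, t} =
    \<sigma>\<^sup>2 / 2 * two_leader_trace n k (cycle_resistance n s t)"
proof -
  let ?G = "two_leader_inverse n k s t" and ?M = "dynamics_matrix (cycle_graph n) k {s, t}"
  let ?r = "cycle_resistance n"
  have carrier: "?G \<in> carrier_mat n n"
    by (simp add: two_leader_inverse_def)
  have "transpose_mat ?M = ?M"
    using n by (intro transpose_mat_eqI[of _ n]) (auto simp: dynamics_cycle_entry laplacian_cycle_sym)
  moreover have "transpose_mat ?G = ?G"
    by (intro transpose_mat_eqI[of _ n])
       (auto simp: two_leader_inverse_def cycle_resistance_commute algebra_simps)
  ultimately have "steady_state_covariance ?M \<sigma> = (\<sigma>\<^sup>2 / 2) \<cdot>\<^sub>m ?G"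
    using carrier dynamics_two_leader_inverse[OF n k st] dynamics_cycle_pos_def[OF n k st(1), of "{s, t}"]
    by (intro steady_state_covariance_eqI) auto
  then have "total_system_error (cycle_graph n) k \<sigma> {s, t} = (\<Sum>i<n. \<sigma>\<^sup>2 / 2 * ?G $$ (i, i))"
    using carrier
    by (simp add: total_system_error_def diag_mat_def sum_list_distinct_conv_sum_set
        lessThan_atLeast0)
  also have "\<dots> = \<sigma>\<^sup>2 / 2 * (\<Sum>i<n. ?r i s / 2 + ?r i t / 2 + (1 / (2 * k) - ?r s t / 4)
      - (?r i s - ?r i t)\<^sup>2 / (4 * (?r s t + 2 / k)))"
    unfolding sum_distrib_left
    by (intro sum.cong) (auto simp: two_leader_inverse_def power2_eq_square field_simps)
  also have "(\<Sum>i<n. ?r i s / 2 + ?r i t / 2 + (1 / (2 * k) - ?r s t / 4)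
      - (?r i s - ?r i t)\<^sup>2 / (4 * (?r s t + 2 / k))) = two_leader_trace n k (?r s t)"
    unfolding sum.distrib sum_subtractf sum_divide_distrib[symmetric]
      sum_cycle_resistance[OF st(1)] sum_cycle_resistance[OF st(2)]
      sum_cycle_resistance_difference_squared[OF st(1,2)]
    by (simp add: two_leader_trace_def algebra_simps diff_divide_distrib)
  finally show ?thesis .
qed

text \<open>
  The linear term decreases strictly. The fraction \<open>r (n r + 2) / (r + 2/k)\<close> increases, since clearing
  denominators for \<open>x < y\<close> leaves a sum of nonnegative terms.
\<close>

lemma two_leader_trace_strict_antimono:
  assumes "0 < k" "0 \<le> x" "x < y" "0 < n"
  shows "two_leader_trace n k y < two_leader_trace n k x"
proof -
  let ?n = "real n"
  define q where "q = 2 / k"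
  have q: "0 < q" using assms by (simp add: q_def)
  then have pos: "0 < 12 * (x + q)" "0 < 12 * (y + q)"
    using assms by auto
  have "0 \<le> ?n * x * y * (y - x) + q * (?n * (y\<^sup>2 - x\<^sup>2) + 2 * (y - x))"
    using assms q by (intro add_nonneg_nonneg mult_nonneg_nonneg) (auto simp: power_mono)
  also have "\<dots> = y * (?n * y + 2) * (x + q) - x * (?n * x + 2) * (y + q)"
    by (simp add: algebra_simps power2_eq_square)
  finally have "x * (?n * x + 2) * (12 * (y + q)) \<le> y * (?n * y + 2) * (12 * (x + q))"
    by (simp add: algebra_simps)
  then have "x * (?n * x + 2) / (12 * (x + q)) \<le> y * (?n * y + 2) / (12 * (y + q))"
    by (subst frac_le_eq) (use pos in \<open>auto intro!: divide_nonpos_pos simp del: distrib_left_numeral\<close>)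
  moreover have "?n * x < ?n * y"
    using assms by simp
  ultimately show ?thesis
    unfolding two_leader_trace_def q_def by linarith
qed

section \<open>Geodesic distance\<close>

lemma cycle_walk_exists:
  assumes "3 \<le> n" "u < n"
  shows "\<exists>p. pre_digraph.awalk (with_proj (cycle_graph n)) u p ((u + m) mod n) \<and> length p = m"
    and "\<exists>p. pre_digraph.awalk (with_proj (cycle_graph n)) ((u + m) mod n) p u \<and> length p = m"
proof -
  interpret pair_graph "cycle_graph n"
    using assms(1) by (rule pair_graph_cycle_graph)
  have verts: "u \<in> pverts (cycle_graph n)"
    using assms by (simp add: cycle_graph_def)
  have arcs: "((u + m) mod n, (u + Suc m) mod n) \<in> parcs (cycle_graph n)"
    "((u + Suc m) mod n, (u + m) mod n) \<in> parcs (cycle_graph n)" for m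
    using assms by (auto simp: cycle_graph_def mod_Suc_eq)
  have ends: "(u + m) mod n \<in> pverts (cycle_graph n)" for m
    using assms by (simp add: cycle_graph_def)
  show "\<exists>p. awalk u p ((u + m) mod n) \<and> length p = m"
  proof (induction m)
    case 0
    then show ?case using assms verts by (simp add: awalk_Nil_iff)
  next
    case (Suc m)
    then obtain p where p: "awalk u p ((u + m) mod n)" "length p = m" by blast
    have "awalk ((u + m) mod n) [((u + m) mod n, (u + Suc m) mod n)] ((u + Suc m) mod n)"
      using arcs ends by (simp add: awalk_Cons_iff awalk_Nil_iff del: add_Suc_right)
    with p have "awalk u (p @ [((u + m) mod n, (u + Suc m) mod n)]) ((u + Suc m) mod n)"
      by (blast intro: awalk_appendI)
    then show ?case using p(2) by (metis length_append_singleton)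
  qed
  show "\<exists>p. awalk ((u + m) mod n) p u \<and> length p = m"
  proof (induction m)
    case 0
    then show ?case using assms verts by (simp add: awalk_Nil_iff)
  next
    case (Suc m)
    then obtain p where p: "awalk ((u + m) mod n) p u" "length p = m" by blast
    then have "awalk ((u + Suc m) mod n) (((u + Suc m) mod n, (u + m) mod n) # p) u"
      using arcs by (simp add: awalk_Cons_iff del: add_Suc_right)
    then show ?case using p(2) by (metis length_Cons)
  qed
qed

definition cycle_distance :: "nat \<Rightarrow> nat \<Rightarrow> nat \<Rightarrow> real" where
  "cycle_distance n u v = min \<bar>real u - real v\<bar> (real n - \<bar>real u - real v\<bar>)"

text \<open>
  A step of a walk changes the cyclic distance to a fixed node by at most 1, so this distance bounds the
  length of every walk to that node from below.
\<close>

lemma cycle_distance_arc: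
  assumes "(u, w) \<in> parcs (cycle_graph n)" "v < n"
  shows "cycle_distance n u v \<le> 1 + cycle_distance n w v"
proof -
  have "u < n" "w < n" and "w = Suc u mod n \<or> u = Suc w mod n"
    using assms(1) by (auto simp: cycle_graph_def)
  then have "w = Suc u \<or> u = Suc w \<or> (u = 0 \<and> Suc w = n) \<or> (w = 0 \<and> Suc u = n)"
    by (auto simp: mod_Suc split: if_splits)
  then show ?thesis
    using \<open>u < n\<close> \<open>w < n\<close> \<open>v < n\<close> by (auto simp: cycle_distance_def min_def abs_if)
qed

text \<open>
  The two ways round the cycle are walks of lengths \<open>D\<close> and \<open>n - D\<close>. In one of them the
  indices increase (modulo \<open>n\<close>) and in the other they decrease, hence both directions of the walks above.
\<close>

lemma geodesic_distance_cycle_graph: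
  assumes "3 \<le> n" "u < n" "v < n"
  shows "geodesic_distance (cycle_graph n) u v = ereal (cycle_distance n u v)"
proof -
  interpret pair_graph "cycle_graph n"
    using assms(1) by (rule pair_graph_cycle_graph)
  have cost: "awalk_cost (\<lambda>_. 1) p = real (length p)" for p
    by (induction p) auto
  have lower: "cycle_distance n x v \<le> real (length p)" if "awalk x p v" for x p
    using that
  proof (induction p arbitrary: x)
    case Nil
    then show ?case by (simp add: awalk_Nil_iff cycle_distance_def)
  next
    case (Cons e p)
    then have "(x, snd e) \<in> parcs (cycle_graph n)" "awalk (snd e) p v"
      by (auto simp: awalk_Cons_iff)
    with Cons.IH[of "snd e"] show ?case
      using cycle_distance_arc[of x "snd e" n v] assms(3) by simp
  qed
  have walk: "\<exists>p. awalk x p y \<and> length p = m" if "x < n" "(x + m) mod n = y \<or> (y + m) mod n = x" "y < n" for x y m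
    using that cycle_walk_exists[OF assms(1), of x m] cycle_walk_exists[OF assms(1), of y m] by auto
  have "\<exists>p. awalk u p v \<and> real (length p) = cycle_distance n u v"
  proof -
    define d where "d = (if u \<le> v then v - u else u - v)"
    have D: "\<bar>real u - real v\<bar> = real d" and "d < n"
      using assms by (auto simp: d_def)
    have "\<exists>p. awalk u p v \<and> length p = d"
      by (rule walk) (use assms in \<open>auto simp: d_def\<close>)
    moreover have "\<exists>p. awalk u p v \<and> length p = n - d"
      by (rule walk) (use assms in \<open>auto simp: d_def\<close>)
    ultimately show ?thesis
      using \<open>d < n\<close> by (auto simp: cycle_distance_def D min_def of_nat_diff)
  qed
  then obtain p where p: "awalk u p v" "real (length p) = cycle_distance n u v" by blast
  show ?thesis
    unfolding geodesic_distance_def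
  proof (rule antisym)
    show "\<mu> (\<lambda>_. 1) u v \<le> ereal (cycle_distance n u v)"
      using min_cost_le_walk_cost[OF p(1), of "\<lambda>_. 1"] p(2) by (simp add: cost)
    show "ereal (cycle_distance n u v) \<le> \<mu> (\<lambda>_. 1) u v"
      unfolding \<mu>_def by (intro INF_greatest) (auto simp: cost lower)
  qed
qed

section \<open>Antipodal pairs are optimal\<close>

lemma quarter_minus_cycle_resistance:
  assumes "0 < n"
  shows "real n / 4 - cycle_resistance n u v = (real n - 2 * \<bar>real u - real v\<bar>)\<^sup>2 / (4 * real n)"
  using assms by (simp add: cycle_resistance_def field_simps power2_eq_square)

lemma cycle_resistance_le_quarter:
  assumes "0 < n"
  shows "cycle_resistance n u v \<le> real n / 4"
proof -
  have "0 \<le> real n / 4 - cycle_resistance n u v"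
    unfolding quarter_minus_cycle_resistance[OF assms] by simp
  then show ?thesis by simp
qed

lemma cycle_resistance_eq_quarter_iff:
  assumes "0 < n"
  shows "cycle_resistance n u v = real n / 4 \<longleftrightarrow> 2 * \<bar>real u - real v\<bar> = real n"
proof -
  have "cycle_resistance n u v = real n / 4 \<longleftrightarrow> real n / 4 - cycle_resistance n u v = 0"
    by auto
  also have "\<dots> \<longleftrightarrow> 2 * \<bar>real u - real v\<bar> = real n"
    unfolding quarter_minus_cycle_resistance[OF assms] using assms by auto
  finally show ?thesis .
qed

lemma cycle_resistance_half:
  assumes "even n" "0 < n"
  shows "cycle_resistance n 0 (n div 2) = real n / 4"
  unfolding cycle_resistance_eq_quarter_iff[OF assms(2)] using assms(1) by auto

lemma antipodal_cong_iff:
  assumes "even n" "u < n" "v < n"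
  shows "[v = u + n div 2] (mod n) \<longleftrightarrow> 2 * \<bar>real u - real v\<bar> = real n"
proof -
  obtain h where n: "n = 2 * h" using assms(1) by blast
  have "(u + h) mod n = (if u + h < n then u + h else u + h - n)"
    using assms(2) n by (auto simp: mod_if)
  then have "[v = u + n div 2] (mod n) \<longleftrightarrow> v = u + h \<or> u = v + h"
    using assms n by (auto simp: cong_def)
  also have "\<dots> \<longleftrightarrow> 2 * \<bar>real u - real v\<bar> = real n"
    unfolding n by (auto simp: abs_if)
  finally show ?thesis .
qed

lemma max_resistance_pair_cycle_iff:
  assumes "even n" "4 \<le> n" "u < n" "v < n"
  shows "max_resistance_pair (cycle_graph n) u v \<longleftrightarrow> cycle_resistance n u v = real n / 4"
proof
  have half: "cycle_resistance n 0 (n div 2) = real n / 4"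
    using assms by (intro cycle_resistance_half) auto
  assume "max_resistance_pair (cycle_graph n) u v"
  then have "resistance_distance (cycle_graph n) 0 (n div 2) \<le> resistance_distance (cycle_graph n) u v"
    using assms by (auto simp: max_resistance_pair_def cycle_graph_def)
  then show "cycle_resistance n u v = real n / 4"
    using assms half cycle_resistance_le_quarter[of n u v]
    by (simp add: resistance_distance_cycle_graph)
next
  assume max: "cycle_resistance n u v = real n / 4"
  then have "u \<noteq> v" using assms by auto
  moreover have "resistance_distance (cycle_graph n) x y \<le> resistance_distance (cycle_graph n) u v"
    if "x < n" "y < n" for x y
    using that assms max cycle_resistance_le_quarter[of n x y]
    by (simp add: resistance_distance_cycle_graph)
  moreover have "pverts (cycle_graph n) = {..<n}"
    by (simp add: cycle_graph_def)
  ultimately show "max_resistance_pair (cycle_graph n) u v"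
    using assms(3,4) by (simp add: max_resistance_pair_def)
qed

theorem corollary2:
  fixes n :: nat and k \<sigma> :: real
  assumes "even n" and "4 \<le> n" and "0 < k" and "0 < \<sigma>"
  shows "(\<forall>S. optimal_leader_set (cycle_graph n) k \<sigma> 2 S \<longleftrightarrow>
            (\<exists>s1 s2. S = {s1, s2} \<and> max_resistance_pair (cycle_graph n) s1 s2)) \<and>
         (\<forall>s1 < n. \<forall>s2 < n. s1 \<noteq> s2 \<longrightarrow>
            (max_resistance_pair (cycle_graph n) s1 s2 \<longleftrightarrow>
               resistance_distance (cycle_graph n) s1 s2 = real n / 4) \<and>
            (max_resistance_pair (cycle_graph n) s1 s2 \<longleftrightarrow>
               geodesic_distance (cycle_graph n) s1 s2 = ereal (real n / 2)) \<and>
            (max_resistance_pair (cycle_graph n) s1 s2 \<longleftrightarrow>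
               [s2 = s1 + n div 2] (mod n)))"
proof (intro conjI allI impI)
  have n: "3 \<le> n" "0 < n" using \<open>4 \<le> n\<close> by auto
  have verts: "pverts (cycle_graph n) = {..<n}" by (simp add: cycle_graph_def)
  let ?r = "cycle_resistance n" and ?E = "total_system_error (cycle_graph n) k \<sigma>"
  have less: "?E {c, d} < ?E {a, b}"
    if "?r a b < ?r c d" "a < n" "b < n" "a \<noteq> b" "c < n" "d < n" "c \<noteq> d" for a b c d
    using two_leader_trace_strict_antimono[OF \<open>0 < k\<close> cycle_resistance_nonneg that(1) n(2)] that \<open>0 < \<sigma>\<close>
    by (simp add: total_system_error_cycle[OF n(1) \<open>0 < k\<close>])
  have le: "?E {c, d} \<le> ?E {a, b}"
    if "?r a b \<le> ?r c d" "a < n" "b < n" "a \<noteq> b" "c < n" "d < n" "c \<noteq> d" for a b c d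
    using less[OF _ that(2-7)] that(1)
    by (cases "?r a b = ?r c d") (auto simp: total_system_error_cycle[OF n(1) \<open>0 < k\<close>] that)
  fix S
  show "optimal_leader_set (cycle_graph n) k \<sigma> 2 S \<longleftrightarrow>
      (\<exists>s1 s2. S = {s1, s2} \<and> max_resistance_pair (cycle_graph n) s1 s2)"
  proof
    assume opt: "optimal_leader_set (cycle_graph n) k \<sigma> 2 S"
    then obtain a b where S: "S = {a, b}" "a \<noteq> b"
      by (auto simp: optimal_leader_set_def card_2_iff)
    with opt have ab: "a < n" "b < n"
      by (auto simp: optimal_leader_set_def verts)
    have "n div 2 < n" "0 \<noteq> n div 2" using \<open>4 \<le> n\<close> by auto
    moreover from this have "?E S \<le> ?E {0, n div 2}"
      using opt n(2) by (auto simp: optimal_leader_set_def verts)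
    ultimately have "\<not> ?r a b < ?r 0 (n div 2)"
      using less[of a b 0 "n div 2"] S ab n(2) by auto
    moreover have "?r 0 (n div 2) = real n / 4"
      using assms(1) n(2) by (rule cycle_resistance_half)
    ultimately have "?r a b = real n / 4"
      using cycle_resistance_le_quarter[OF n(2), of a b] by simp
    then show "\<exists>s1 s2. S = {s1, s2} \<and> max_resistance_pair (cycle_graph n) s1 s2"
      using S ab max_resistance_pair_cycle_iff[OF assms(1,2)] by blast
  next
    assume "\<exists>s1 s2. S = {s1, s2} \<and> max_resistance_pair (cycle_graph n) s1 s2"
    then obtain a b where S: "S = {a, b}" and max: "max_resistance_pair (cycle_graph n) a b"
      by blast
    from max have ab: "a < n" "b < n" "a \<noteq> b"
      by (auto simp: max_resistance_pair_def verts)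
    with max have r: "?r a b = real n / 4"
      using max_resistance_pair_cycle_iff[OF assms(1,2)] by blast
    have "?E S \<le> ?E T" if T: "T \<subseteq> {..<n}" "card T = 2" for T
    proof -
      obtain c d where cd: "T = {c, d}" "c \<noteq> d"
        using T(2) by (auto simp: card_2_iff)
      then show ?thesis
        using T(1) S ab r le[of c d a b] cycle_resistance_le_quarter[OF n(2), of c d] by auto
    qed
    then show "optimal_leader_set (cycle_graph n) k \<sigma> 2 S"
      using S ab by (auto simp: optimal_leader_set_def verts)
  qed
next
  fix s1 s2 assume s: "s1 < n" "s2 < n"
  have n: "3 \<le> n" "0 < n" using \<open>4 \<le> n\<close> by auto
  note max_iff = max_resistance_pair_cycle_iff[OF assms(1,2) s]
  show "max_resistance_pair (cycle_graph n) s1 s2 \<longleftrightarrow>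
      resistance_distance (cycle_graph n) s1 s2 = real n / 4"
    using max_iff resistance_distance_cycle_graph[OF n(1) s] by simp
  show "max_resistance_pair (cycle_graph n) s1 s2 \<longleftrightarrow>
      geodesic_distance (cycle_graph n) s1 s2 = ereal (real n / 2)"
    unfolding max_iff geodesic_distance_cycle_graph[OF n(1) s]
      cycle_resistance_eq_quarter_iff[OF n(2)]
    by (auto simp: cycle_distance_def min_def)
  show "max_resistance_pair (cycle_graph n) s1 s2 \<longleftrightarrow> [s2 = s1 + n div 2] (mod n)"
    unfolding max_iff cycle_resistance_eq_quarter_iff[OF n(2)]
      antipodal_cong_iff[OF assms(1) s] by (rule refl)
qed

end
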